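(* Let $m>1$ be a divisor of a positive integer $n$ and write $n=n_1n_2$, where $\mathrm{rad}(n_1)$ divides $\frac nm$ and $\gcd\left(n_2,\frac nm\right)=1$. Then the number of distinct $(n,m)$-p.a.p.'s equals $$(m-1)!\cdot\left(\frac{n\cdot n_2\cdot\varphi(n_1)}{m^2}\right)^m.$$
   Context: For a positive integer $k$, $[1,k]=\{1,\dots,k\}$. For an integer $k>1$ and a positive integer $a$, $\Psi_k(a)$ is the unique element of $[1,k]$ congruent to $a$ modulo $k$. $\mathcal C(m)$ is the set of vectors $\vec c\in[1,m]^m$ whose entries comprise a permutation of $[1,m]$. The $i$-th coordinate of $\vec a$ is denoted $a_i$ (similarly for other vectors), and indices of coordinates are taken modulo $m$. $\mathrm{rad}(N)$ is the product of the distinct prime divisors of $N$, with $\mathrm{rad}(1)=1$; $\varphi$ is Euler's totient function. An $(n,m)$-piecewise affine permutation ($(n,m)$-p.a.p.) is a permutation $\pi$ of $[1,n]$ such that there exist $\vec a,\vec b\in[1,n]^m$ and $\vec c\in\mathcal C(m)$ with the property that $\pi(x)=\Psi_n(a_ix+b_i)$ and $\Psi_m(\pi(x))=c_{i+1}$ for any $x\in[1,n]$ with $\Psi_m(x)=c_i$. Distinct $(n,m)$-p.a.p.'s are counted as permutations of $[1,n]$. *)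

theory Defs
  imports "HOL-Number_Theory.Number_Theory" "HOL-Combinatorics.Permutations" "HOL-Library.FuncSet"
begin

definition rad :: "nat \<Rightarrow> nat" where
  "rad N = \<Prod>(prime_factors N)"

definition Psi :: "nat \<Rightarrow> nat \<Rightarrow> nat" where
  "Psi k a = (THE x. x \<in> {1..k} \<and> [x = a] (mod k))"

(* Vectors of length m are functions on the index set {1..m}, undefined elsewhere. *)
definition vectors :: "nat \<Rightarrow> nat \<Rightarrow> (nat \<Rightarrow> nat) set" where
  "vectors k m = {1..m} \<rightarrow>\<^sub>E {1..k}"

definition perm_vectors :: "nat \<Rightarrow> (nat \<Rightarrow> nat) set" where
  "perm_vectors m = {c \<in> vectors m m. bij_betw c {1..m} {1..m}}"

(* The index i + 1 is read modulo m, with representatives in {1..m}, so the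
   successor of m is 1.  A permutation of {1..n} is a function on nat fixing
   every point outside {1..n}, so distinct permutations are distinct functions. *)
definition pap :: "nat \<Rightarrow> nat \<Rightarrow> (nat \<Rightarrow> nat) \<Rightarrow> bool" where
  "pap n m \<pi> \<longleftrightarrow>
     \<pi> permutes {1..n} \<and>
     (\<exists>a \<in> vectors n m. \<exists>b \<in> vectors n m. \<exists>c \<in> perm_vectors m.
        \<forall>i \<in> {1..m}. \<forall>x \<in> {1..n}. Psi m x = c i \<longrightarrow>
          \<pi> x = Psi n (a i * x + b i) \<and> Psi m (\<pi> x) = c (Psi m (i + 1)))"

end

theory Submission
  imports Defs
begin

text \<open>
  Put \<open>N = n div m\<close>.  A p.a.p. induces on the residues modulo \<open>m\<close> an \<open>m\<close>-cycle,
  of which there are \<open>(m - 1)!\<close>: rotating \<open>c\<close> so that \<open>c m = m\<close> leaves an arbitrary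
  permutation of \<open>{1..m - 1}\<close>.  Writing \<open>x = r + m t\<close> with \<open>r \<in> {1..m}\<close>, the class of \<open>r\<close>
  is mapped to that of its successor by a bijection \<open>t \<mapsto> u + a t\<close> of the integers modulo
  \<open>N\<close>; it is determined by \<open>a\<close>, a unit modulo \<open>N\<close>, and by \<open>u\<close>, and every such pair occurs
  independently for each \<open>r\<close>.  Hence the count is \<open>(m - 1)! (N \<phi>(N))^m\<close>.  The hypotheses
  on \<open>n1\<close> and \<open>n2\<close> say that \<open>n1\<close> and \<open>N\<close> have the same prime divisors, so that
  \<open>\<phi>(n1) / n1 = \<phi>(N) / N\<close>.
\<close>

section \<open>Representatives in \<open>{1..k}\<close> and division with remainder in that
  range\<close>

lemma Psi_altdef:
  assumes "k > 0"
  shows "Psi k a = (if a mod k = 0 then k else a mod k)"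
  unfolding Psi_def
proof (rule the_equality)
  show "(if a mod k = 0 then k else a mod k) \<in> {1..k} \<and>
      [(if a mod k = 0 then k else a mod k) = a] (mod k)"
    using assms by (auto simp: cong_def intro: less_imp_le)
next
  fix x assume x: "x \<in> {1..k} \<and> [x = a] (mod k)"
  then show "x = (if a mod k = 0 then k else a mod k)"
    by (cases "x = k") (auto simp: cong_def)
qed

lemma Psi_in: "k > 0 \<Longrightarrow> Psi k a \<in> {1..k}"
  by (auto simp: Psi_altdef intro: less_imp_le)

lemma Psi_cong: "k > 0 \<Longrightarrow> [Psi k a = a] (mod k)"
  by (auto simp: Psi_altdef cong_def)

lemma Psi_eq_iff: "k > 0 \<Longrightarrow> Psi k a = Psi k b \<longleftrightarrow> [a = b] (mod k)"
  using Psi_cong[of k a] Psi_cong[of k b] by (metis Psi_altdef cong_def)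

lemma Psi_id: "x \<in> {1..k} \<Longrightarrow> Psi k x = x"
  by (cases "x = k") (auto simp: Psi_altdef)

lemma Psi_eqI: "x \<in> {1..k} \<Longrightarrow> [x = a] (mod k) \<Longrightarrow> Psi k a = x"
  using Psi_eq_iff[of k a x] Psi_id[of x k] by (auto simp: cong_sym)

lemma Psi_add_mult: "r \<in> {1..m} \<Longrightarrow> Psi m (r + m * t) = r"
  by (rule Psi_eqI) (auto simp: cong_def)

text \<open>Remainders run over \<open>{1..m}\<close> instead of \<open>{0..m - 1}\<close>, so the
  quotient is read off after subtracting 1; otherwise the class of \<open>m\<close> would be off by
  one.\<close>

lemma div_add_mult: "r \<in> {1..m} \<Longrightarrow> (r + m * t - 1) div m = (t::nat)"
proof -
  assume r: "r \<in> {1..m}"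
  then have "r + m * t - 1 = (r - 1) + m * t" by auto
  moreover have "(r - 1) div m = 0" "m > 0" using r by auto
  ultimately show ?thesis by simp
qed

lemma Psi_decomp:
  assumes "m > 0" "x > 0"
  shows "x = Psi m x + m * ((x - 1) div m)"
proof -
  define r where "r = (x - 1) mod m + 1"
  have r: "r \<in> {1..m}" using assms by (auto simp: r_def Suc_le_eq)
  have x: "x = r + m * ((x - 1) div m)"
    using assms mod_mult_div_eq[of "x - 1" m] by (simp add: r_def)
  have "Psi m x = r" using Psi_add_mult[OF r, of "(x - 1) div m"] x by simp
  then show ?thesis using x by simp
qed

lemma add_mult_in_range:
  fixes r t m N :: nat
  assumes "r \<in> {1..m}" "t < N"
  shows "r + m * t \<in> {1..m * N}"
proof -
  have "r + m * t \<le> m * (t + 1)" using assms by (simp add: algebra_simps)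
  also have "\<dots> \<le> m * N" using assms by (intro mult_le_mono) auto
  finally show ?thesis using assms by auto
qed

text \<open>Changing the quotient by a multiple of \<open>N\<close> changes the number by a multiple
  of \<open>m * N\<close>. This turns a congruence modulo \<open>n\<close> on one residue class into
  arithmetic modulo \<open>N\<close> on quotients.\<close>

lemma cong_add_mult_mod:
  fixes s m k N :: nat
  shows "[s + m * k = s + m * (k mod N)] (mod (m * N))"
proof (rule cong_add[OF cong_refl])
  show "[m * k = m * (k mod N)] (mod (m * N))"
    unfolding cong_def mult_mod_right mod_mod_trivial ..
qed

lemma quot_less:
  fixes x m N :: nat
  assumes "x \<in> {1..m * N}"
  shows "(x - 1) div m < N"
  using assms by (intro less_mult_imp_div_less) (auto simp: mult.commute)

section \<open>Cycles on the residues modulo \<open>m\<close>\<close>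

lemma bij_betw_Psi_add:
  assumes "m > 0"
  shows "bij_betw (\<lambda>i. Psi m (i + j)) {1..m} {1..m}"
proof -
  have inj: "inj_on (\<lambda>i. Psi m (i + j)) {1..m}"
  proof (rule inj_onI)
    fix x y assume xy: "x \<in> {1..m}" "y \<in> {1..m}" "Psi m (x + j) = Psi m (y + j)"
    then have "[x = y] (mod m)"
      using assms by (simp add: Psi_eq_iff cong_add_rcancel_nat)
    then show "x = y" using xy assms Psi_id by (metis Psi_eq_iff)
  qed
  have "(\<lambda>i. Psi m (i + j)) ` {1..m} \<subseteq> {1..m}" using assms Psi_in by blast
  then have "(\<lambda>i. Psi m (i + j)) ` {1..m} = {1..m}"
    using inj by (intro endo_inj_surj) auto
  with inj show ?thesis by (simp add: bij_betw_def)
qed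

text \<open>The successor of \<open>r\<close> in the cycle \<open>(p 1, \<dots>, p m)\<close>.\<close>

definition cyc_succ :: "nat \<Rightarrow> (nat \<Rightarrow> nat) \<Rightarrow> nat \<Rightarrow> nat" where
  "cyc_succ m p r = p (Psi m (inv_into UNIV p r + 1))"

lemma permutes_extend:
  assumes "p permutes {1..m - 1}"
  shows "p permutes {1..m::nat}" "m > 0 \<Longrightarrow> p m = m"
proof -
  show "p permutes {1..m}" using assms by (rule permutes_subset) auto
  show "m > 0 \<Longrightarrow> p m = m" using permutes_not_in[OF assms, of m] by auto
qed

lemma cyc_succ_apply: "p permutes S \<Longrightarrow> cyc_succ m p (p i) = p (Psi m (i + 1))"
  by (simp add: cyc_succ_def permutes_inverses)

lemma cyc_succ_bij:
  assumes "m > 0" "p permutes {1..m}"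
  shows "bij_betw (cyc_succ m p) {1..m} {1..m}"
proof -
  have "bij_betw (p \<circ> (\<lambda>i. Psi m (i + 1)) \<circ> inv_into UNIV p) {1..m} {1..m}"
    by (rule bij_betw_trans[OF permutes_imp_bij[OF permutes_inv[OF assms(2)]]
          bij_betw_trans[OF bij_betw_Psi_add[OF assms(1)] permutes_imp_bij[OF assms(2)]]])
  moreover have "p \<circ> (\<lambda>i. Psi m (i + 1)) \<circ> inv_into UNIV p = cyc_succ m p"
    by (auto simp: cyc_succ_def)
  ultimately show ?thesis by simp
qed

text \<open>Both \<open>p\<close> and \<open>q\<close> fix \<open>m\<close>, so the two cycles share
  a starting point, and following the common successor map from there recovers every later entry.
  Without this normalization, rotations of one cycle would be indistinguishable.\<close>

lemma cyc_succ_inj: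
  assumes "m > 0" "p permutes {1..m - 1}" "q permutes {1..m - 1}"
    and eq: "\<And>r. r \<in> {1..m} \<Longrightarrow> cyc_succ m p r = cyc_succ m q r"
  shows "p = q"
proof
  note p = permutes_extend(1)[OF assms(2)] and q = permutes_extend(1)[OF assms(3)]
  \<comment> \<open>The induction runs over all naturals, with position 0 standing for position
    \<open>m\<close>, where both cycles have the entry \<open>m\<close>.\<close>
  have *: "p (Psi m i) = q (Psi m i)" for i
  proof (induction i)
    case 0
    have "Psi m 0 = m" using assms(1) by (simp add: Psi_altdef)
    then show ?case
      using permutes_extend(2)[OF assms(2,1)] permutes_extend(2)[OF assms(3,1)] by simp
  next
    case (Suc i)
    have s: "Psi m (Psi m i + 1) = Psi m (Suc i)"
      unfolding Psi_eq_iff[OF assms(1)] Suc_eq_plus1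
      using Psi_cong[OF assms(1)] by (rule cong_add[OF _ cong_refl])
    have "p (Psi m i) \<in> {1..m}"
      using Psi_in[OF assms(1)] permutes_in_image[OF p] by blast
    then have "cyc_succ m p (p (Psi m i)) = cyc_succ m q (q (Psi m i))"
      using eq Suc.IH by (simp only:)
    then show ?case
      unfolding cyc_succ_apply[OF p] cyc_succ_apply[OF q] s .
  qed
  fix i
  show "p i = q i"
  proof (cases "i \<in> {1..m}")
    case True
    show ?thesis using *[of i] unfolding Psi_id[OF True] .
  next
    case False
    show ?thesis using permutes_not_in[OF p False] permutes_not_in[OF q False] by (rule trans[OF _ sym])
  qed
qed

text \<open>Rotating a cyclic list leaves the successor of each entry unchanged, so \<open>c\<close>
  may be rotated until \<open>m\<close> stands at position \<open>m\<close>.\<close>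

lemma perm_vector_cyc_succ:
  assumes "m > 0" "c \<in> perm_vectors m"
  obtains p where "p permutes {1..m - 1}"
    and "\<And>i. i \<in> {1..m} \<Longrightarrow> cyc_succ m p (c i) = c (Psi m (i + 1))"
proof -
  have c: "bij_betw c {1..m} {1..m}" using assms by (simp add: perm_vectors_def)
  then have "m \<in> c ` {1..m}" using assms by (simp add: bij_betw_def)
  then obtain j where j: "j \<in> {1..m}" "c j = m" by auto
  define p where "p = (\<lambda>i. if i \<in> {1..m} then c (Psi m (i + j)) else i)"
  have "bij_betw (c \<circ> (\<lambda>i. Psi m (i + j))) {1..m} {1..m}"
    using bij_betw_Psi_add[OF assms(1)] c by (rule bij_betw_trans)
  then have "bij_betw p {1..m} {1..m}"
    by (rule bij_betw_cong[THEN iffD1, rotated]) (simp add: p_def)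
  then have pm: "p permutes {1..m}"
    by (rule bij_imp_permutes) (simp only: p_def if_False)
  have "p m = m"
  proof -
    have "Psi m (m + j) = j" using j by (intro Psi_eqI) (auto simp: cong_def)
    then show ?thesis using j by (simp add: p_def)
  qed
  have p1: "p permutes {1..m - 1}"
  proof (rule permutes_superset[OF pm])
    fix x assume "x \<in> {1..m} - {1..m - 1}"
    then have "x = m" by auto
    then show "p x = x" using \<open>p m = m\<close> by simp
  qed
  show ?thesis
  proof (rule that[OF p1])
    fix i assume i: "i \<in> {1..m}"
    \<comment> \<open>The position of \<open>c i\<close> after the rotation by \<open>j\<close>;
      adding \<open>m - j\<close> plays the role of subtracting \<open>j\<close>.\<close>
    define k where "k = Psi m (i + (m - j))"
    have k: "k \<in> {1..m}" using assms Psi_in by (simp add: k_def)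
    have kc: "[k = i + (m - j)] (mod m)" unfolding k_def using assms Psi_cong by blast
    have kj: "[k + j = i] (mod m)"
      using cong_add[OF kc cong_refl[of j]] j by (simp add: cong_def)
    have pk: "p k = c i"
      using Psi_eqI[OF i cong_sym[OF kj]] k by (simp add: p_def)
    have "Psi m (Psi m (k + 1) + j) = Psi m (i + 1)"
    proof -
      have "[Psi m (k + 1) + j = k + 1 + j] (mod m)"
        using assms Psi_cong by (intro cong_add) auto
      also have "[k + 1 + j = i + 1] (mod m)"
        using cong_add[OF kj cong_refl[of 1]] by (simp add: ac_simps)
      finally show ?thesis using assms by (simp add: Psi_eq_iff)
    qed
    then have "p (Psi m (k + 1)) = c (Psi m (i + 1))"
      using Psi_in[OF assms(1), of "k + 1"] by (simp add: p_def)
    then show "cyc_succ m p (c i) = c (Psi m (i + 1))"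
      using cyc_succ_apply[OF pm, of m k] pk by simp
  qed
qed

section \<open>Permutations built from a cycle and affine maps on quotients\<close>

text \<open>The pair \<open>g r = (a, u)\<close> encodes the map \<open>t \<mapsto> u + a t\<close> on the class of \<open>r\<close>.\<close>

definition pap_of :: "nat \<Rightarrow> nat \<Rightarrow> (nat \<Rightarrow> nat) \<Rightarrow> (nat \<Rightarrow> nat \<times> nat) \<Rightarrow> nat \<Rightarrow> nat" where
  "pap_of m N p g x =
     (if x \<in> {1..m * N}
      then cyc_succ m p (Psi m x)
        + m * ((snd (g (Psi m x)) + fst (g (Psi m x)) * ((x - 1) div m)) mod N)
      else x)"

text \<open>Canonical representatives throughout, so that distinct parameters can give distinct
  maps: \<open>p\<close> fixes \<open>m\<close>, the unit lies in \<open>{1..N}\<close> (for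
  \<open>N = 1\<close> the only totative is 1), and the offset lies below \<open>N\<close>.\<close>

abbreviation pap_params :: "nat \<Rightarrow> nat \<Rightarrow> ((nat \<Rightarrow> nat) \<times> (nat \<Rightarrow> nat \<times> nat)) set" where
  "pap_params m N \<equiv>
     {p. p permutes {1..m - 1}} \<times> ({1..m} \<rightarrow>\<^sub>E totatives N \<times> {..<N})"

lemma pap_of_apply:
  assumes "r \<in> {1..m}" "t < N"
  shows "pap_of m N p g (r + m * t) =
    cyc_succ m p r + m * ((snd (g r) + fst (g r) * t) mod N)"
  using assms add_mult_in_range[OF assms]
  by (simp add: pap_of_def Psi_add_mult div_add_mult del: One_nat_def)

lemma residue_quot_cases:
  fixes m N :: nat
  assumes "m > 0" "x \<in> {1..m * N}"
  obtains r t where "r \<in> {1..m}" "t < N" "x = r + m * t"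
  using assms Psi_decomp[of m x] Psi_in[of m x] quot_less[of x m N] by auto

lemma residue_quot_unique:
  fixes m :: nat
  assumes "r + m * t = r' + m * t'" "r \<in> {1..m}" "r' \<in> {1..m}"
  shows "r = r'" "t = t'"
  using assms Psi_add_mult[of r m t] Psi_add_mult[of r' m t']
    div_add_mult[of r m t] div_add_mult[of r' m t'] by simp_all

text \<open>On a finite set injectivity suffices. The residue of the image determines
  \<open>r\<close> because the successor map is a bijection, and then coprimality allows cancelling
  the slope, which determines \<open>t\<close>.\<close>

lemma pap_of_permutes:
  assumes "m > 0" "N > 0" "p permutes {1..m}"
    and g: "\<And>r. r \<in> {1..m} \<Longrightarrow> coprime (fst (g r)) N"
  shows "pap_of m N p g permutes {1..m * N}"
proof (rule bij_imp_permutes)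
  have \<sigma>: "bij_betw (cyc_succ m p) {1..m} {1..m}"
    using assms by (intro cyc_succ_bij)
  have \<sigma>_in: "cyc_succ m p r \<in> {1..m}" if "r \<in> {1..m}" for r
    using \<sigma> that by (rule bij_betwE[rule_format])
  have inj: "inj_on (pap_of m N p g) {1..m * N}"
  proof (rule inj_onI)
    fix x y assume xy: "x \<in> {1..m * N}" "y \<in> {1..m * N}"
      and eq: "pap_of m N p g x = pap_of m N p g y"
    obtain r t where rt: "r \<in> {1..m}" "t < N" "x = r + m * t"
      using residue_quot_cases[OF assms(1) xy(1)] .
    obtain r' t' where rt': "r' \<in> {1..m}" "t' < N" "y = r' + m * t'"
      using residue_quot_cases[OF assms(1) xy(2)] .
    note e = eq[unfolded rt(3) rt'(3) pap_of_apply[OF rt(1,2)] pap_of_apply[OF rt'(1,2)]]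
    note u = residue_quot_unique[OF e \<sigma>_in[OF rt(1)] \<sigma>_in[OF rt'(1)]]
    have r: "r = r'" using u(1) \<sigma> rt rt' by (auto simp: bij_betw_def dest: inj_onD)
    have "[snd (g r) + fst (g r) * t = snd (g r) + fst (g r) * t'] (mod N)"
      using u(2) r by (simp add: cong_def)
    then have "[t = t'] (mod N)"
      using g[OF rt(1)] by (simp add: cong_add_lcancel_nat cong_mult_lcancel_nat)
    then have "t = t'" using rt rt' by (simp add: cong_less_modulus_unique_nat)
    then show "x = y" using r rt rt' by simp
  qed
  have "pap_of m N p g ` {1..m * N} \<subseteq> {1..m * N}"
  proof safe
    fix x assume "x \<in> {1..m * N}"
    then obtain r t where rt: "r \<in> {1..m}" "t < N" "x = r + m * t"
      using residue_quot_cases[OF assms(1)] by blast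
    show "pap_of m N p g x \<in> {1..m * N}"
      unfolding rt(3) pap_of_apply[OF rt(1,2)]
      using \<sigma>_in[OF rt(1)] assms by (intro add_mult_in_range) auto
  qed
  then have "pap_of m N p g ` {1..m * N} = {1..m * N}"
    using inj by (intro endo_inj_surj) auto
  with inj show "bij_betw (pap_of m N p g) {1..m * N} {1..m * N}"
    by (simp add: bij_betw_def)
qed (simp only: pap_of_def if_False)

lemma pap_pap_of:
  assumes "m > 0" "N > 0" "(p, g) \<in> pap_params m N"
  shows "pap (m * N) m (pap_of m N p g)"
proof -
  define n where "n = m * N"
  have n: "n > 0" using assms by (simp add: n_def)
  have p1: "p permutes {1..m - 1}" and g: "g \<in> {1..m} \<rightarrow>\<^sub>E totatives N \<times> {..<N}"
    using assms(3) by (simp_all only: mem_Sigma_iff mem_Collect_eq)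
  note p = permutes_extend(1)[OF p1]
  \<comment> \<open>The parameters \<open>g\<close> are indexed by residues, the vectors of a p.a.p.
    by positions in the cycle; \<open>s\<close>, \<open>a\<close> and \<open>u\<close> re-index by
    position.\<close>
  define s where "s i = p (Psi m (i + 1))" for i
  define a where "a i = fst (g (p i))" for i
  define u where "u i = snd (g (p i))" for i
  have s: "s i \<in> {1..m}" for i
    unfolding s_def permutes_in_image[OF p] by (rule Psi_in[OF assms(1)])
  have perm: "pap_of m N p g permutes {1..n}"
    unfolding n_def
  proof (rule pap_of_permutes[OF assms(1,2) p])
    fix r assume "r \<in> {1..m}"
    then have "g r \<in> totatives N \<times> {..<N}" using g by (rule PiE_mem[rotated])
    then show "coprime (fst (g r)) N" by (auto simp: totatives_def)
  qed
  define c where "c = restrict p {1..m}"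
  have c: "c \<in> perm_vectors m"
  proof -
    have "bij_betw c {1..m} {1..m}"
      using permutes_imp_bij[OF p] by (rule bij_betw_cong[THEN iffD1, rotated]) (simp only: c_def restrict_apply')
    moreover have "c \<in> vectors m m"
      unfolding vectors_def c_def restrict_PiE_iff permutes_in_image[OF p] by (rule ballI)
    ultimately show ?thesis unfolding perm_vectors_def by blast
  qed
  define A where "A = (\<lambda>i\<in>{1..m}. Psi n (a i))"
  \<comment> \<open>For \<open>x = p i + m * t\<close> the offset should be
    \<open>s i + m * u i - a i * p i\<close>; modulo \<open>n\<close> the factor
    \<open>n - 1\<close> serves as -1.\<close>
  define B where "B = (\<lambda>i\<in>{1..m}. Psi n (s i + m * u i + (n - 1) * (a i * p i)))"
  have AB: "A \<in> vectors n m" "B \<in> vectors n m"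
    using Psi_in[OF n] by (auto simp: vectors_def A_def B_def)
  have main: "pap_of m N p g x = Psi n (A i * x + B i) \<and>
      Psi m (pap_of m N p g x) = c (Psi m (i + 1))"
    if i: "i \<in> {1..m}" and x: "x \<in> {1..n}" and ix: "Psi m x = c i" for i x
  proof -
    obtain r t where rt: "r \<in> {1..m}" "t < N" "x = r + m * t"
      using residue_quot_cases[OF assms(1)] x unfolding n_def by blast
    have r: "r = p i" using ix i rt Psi_add_mult[OF rt(1)] by (simp add: c_def)
    have F: "pap_of m N p g x = s i + m * ((u i + a i * t) mod N)"
      unfolding rt(3) pap_of_apply[OF rt(1,2)]
      by (simp add: r cyc_succ_apply[OF p] s_def u_def a_def)
    have "[A i * x = a i * x] (mod n)"
      unfolding A_def restrict_apply'[OF i] by (intro cong_mult Psi_cong[OF n] cong_refl)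
    moreover have "[B i = s i + m * u i + (n - 1) * (a i * p i)] (mod n)"
      unfolding B_def restrict_apply'[OF i] by (rule Psi_cong[OF n])
    ultimately have "[A i * x + B i = a i * x + (s i + m * u i + (n - 1) * (a i * p i))] (mod n)"
      by (rule cong_add)
    moreover have "a i * x + (s i + m * u i + (n - 1) * (a i * p i)) =
        s i + m * (u i + a i * t) + n * (a i * r)"
    proof -
      have "n * (a i * r) = a i * r + (n - 1) * (a i * r)"
        using n by (cases n) simp_all
      then show ?thesis by (simp add: rt(3) r algebra_simps)
    qed
    ultimately have "[A i * x + B i = s i + m * (u i + a i * t) + n * (a i * r)] (mod n)"
      by (simp only:)
    then have "[A i * x + B i = s i + m * (u i + a i * t)] (mod n)"
      by (simp only: cong_def mod_mult_self2)
    then have "[A i * x + B i = s i + m * ((u i + a i * t) mod N)] (mod n)"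
      unfolding n_def by (rule cong_trans[OF _ cong_add_mult_mod])
    moreover have "s i + m * ((u i + a i * t) mod N) \<in> {1..n}"
      unfolding n_def using assms(2) by (intro add_mult_in_range s mod_less_divisor)
    ultimately have "Psi n (A i * x + B i) = s i + m * ((u i + a i * t) mod N)"
      by (metis Psi_eqI cong_sym)
    moreover have "Psi m (pap_of m N p g x) = c (Psi m (i + 1))"
      unfolding F Psi_add_mult[OF s] c_def restrict_apply'[OF Psi_in[OF assms(1)]] by (rule s_def)
    ultimately show ?thesis unfolding F by simp
  qed
  show ?thesis
    unfolding pap_def n_def[symmetric]
    by (intro conjI[OF perm] bexI[OF _ AB(1)] bexI[OF _ AB(2)] bexI[OF _ c] ballI impI main)
qed

text \<open>On each class, the value at quotient 0 reveals the successor and the offset, and the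
  value at quotient 1 then reveals the slope.\<close>

lemma pap_of_inj:
  assumes "m > 0" "N > 0"
  shows "inj_on (\<lambda>(p, g). pap_of m N p g) (pap_params m N)"
proof (rule inj_onI, clarify)
  fix p g q h
  assume p: "p permutes {1..m - 1}" and q: "q permutes {1..m - 1}"
    and g: "g \<in> {1..m} \<rightarrow>\<^sub>E totatives N \<times> {..<N}"
    and h: "h \<in> {1..m} \<rightarrow>\<^sub>E totatives N \<times> {..<N}"
    and eq: "pap_of m N p g = pap_of m N q h"
  have \<sigma>: "cyc_succ m p r \<in> {1..m}" "cyc_succ m q r \<in> {1..m}" if "r \<in> {1..m}" for r
    using cyc_succ_bij[OF assms(1) permutes_extend(1)[OF p]]
      cyc_succ_bij[OF assms(1) permutes_extend(1)[OF q]] that bij_betwE by blast+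
  have *: "cyc_succ m p r = cyc_succ m q r"
      "[snd (g r) + fst (g r) * t = snd (h r) + fst (h r) * t] (mod N)"
    if "r \<in> {1..m}" "t < N" for r t
  proof -
    have "pap_of m N p g (r + m * t) = pap_of m N q h (r + m * t)" by (simp add: eq)
    note residue_quot_unique[OF this[unfolded pap_of_apply[OF that]] \<sigma>[OF that(1)]]
    then show "cyc_succ m p r = cyc_succ m q r"
      "[snd (g r) + fst (g r) * t = snd (h r) + fst (h r) * t] (mod N)"
      by (simp_all add: cong_def)
  qed
  have "p = q" using cyc_succ_inj[OF assms(1) p q] *(1)[of _ 0] assms by blast
  moreover have "g r = h r" if r: "r \<in> {1..m}" for r
  proof -
    have gh: "g r \<in> totatives N \<times> {..<N}" "h r \<in> totatives N \<times> {..<N}"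
      using PiE_mem[OF g r] PiE_mem[OF h r] .
    have "[snd (g r) = snd (h r)] (mod N)" using *(2)[OF r, of 0] assms by simp
    then have u: "snd (g r) = snd (h r)"
      using gh by (auto intro: cong_less_modulus_unique_nat)
    have "[fst (g r) = fst (h r)] (mod N)"
    \<comment> \<open>Quotient 1 is available only if \<open>N > 1\<close>; modulo 1 the congruence
      is trivial.\<close>
    proof (cases "N = 1")
      case False
      then show ?thesis
        using *(2)[OF r, of 1] assms u by (simp add: cong_add_lcancel_nat)
    qed simp
    moreover have "fst (g r) \<in> {1..N}" "fst (h r) \<in> {1..N}"
      using gh by (auto simp: totatives_def)
    ultimately have "fst (g r) = fst (h r)"
      using assms Psi_id Psi_eq_iff by metis
    then show ?thesis using u by (simp add: prod_eq_iff)
  qed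
  then have "g = h" using g h by (intro PiE_ext) auto
  ultimately show "p = q \<and> g = h" by blast
qed

section \<open>Every p.a.p. arises from parameters\<close>

lemma pap_imp_pap_of:
  assumes "m > 0" "N > 0" "pap (m * N) m \<pi>"
  obtains p g where "(p, g) \<in> pap_params m N" "\<pi> = pap_of m N p g"
proof -
  define n where "n = m * N"
  have n: "n > 0" using assms by (simp add: n_def)
  obtain a b c where perm: "\<pi> permutes {1..n}" and c: "c \<in> perm_vectors m"
    and abc: "\<And>i x. i \<in> {1..m} \<Longrightarrow> x \<in> {1..n} \<Longrightarrow> Psi m x = c i \<Longrightarrow>
      \<pi> x = Psi n (a i * x + b i) \<and> Psi m (\<pi> x) = c (Psi m (i + 1))"
    using assms unfolding pap_def n_def by blast
  obtain p where p: "p permutes {1..m - 1}"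
    and \<sigma>: "\<And>i. i \<in> {1..m} \<Longrightarrow> cyc_succ m p (c i) = c (Psi m (i + 1))"
    using perm_vector_cyc_succ[OF assms(1) c] by blast
  have \<sigma>_in: "cyc_succ m p r \<in> {1..m}" if "r \<in> {1..m}" for r
    using cyc_succ_bij[OF assms(1) permutes_extend(1)[OF p]] that bij_betwE by blast
  \<comment> \<open>\<open>k r\<close> is the position of the residue \<open>r\<close> in the cycle
    \<open>c\<close>.\<close>
  define k where "k = inv_into {1..m} c"
  have k: "k r \<in> {1..m}" "c (k r) = r" if "r \<in> {1..m}" for r
  proof -
    have "r \<in> c ` {1..m}" using c that by (simp add: perm_vectors_def bij_betw_def)
    then show "k r \<in> {1..m}" "c (k r) = r"
      unfolding k_def by (rule inv_into_into, rule f_inv_into_f)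
  qed
  define u where "u r = (\<pi> r - 1) div m" for r
  \<comment> \<open>Compare with the value at \<open>r\<close>: modulo \<open>n\<close>, moving from
    \<open>r\<close> to \<open>r + m * t\<close> adds \<open>m * (a (k r) * t)\<close>, and
    \<open>b (k r)\<close> is absorbed into \<open>\<pi> r\<close>, whose quotient is
    \<open>u r\<close>.\<close>
  have form: "\<pi> (r + m * t) = cyc_succ m p r + m * ((u r + a (k r) * t) mod N)"
    if r: "r \<in> {1..m}" and t: "t < N" for r t
  proof -
    have rn: "r + m * t \<in> {1..n}" "r \<in> {1..n}"
      using add_mult_in_range[OF r t] add_mult_in_range[OF r assms(2)] by (simp_all add: n_def)
    have 1: "\<pi> (r + m * t) = Psi n (a (k r) * (r + m * t) + b (k r))"
      using abc[OF k(1)[OF r] rn(1)] Psi_add_mult[OF r] k(2)[OF r] by simp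
    have 2: "\<pi> r = Psi n (a (k r) * r + b (k r))" "Psi m (\<pi> r) = cyc_succ m p r"
      using abc[OF k(1)[OF r] rn(2)] Psi_id[OF r] k(2)[OF r] \<sigma>[OF k(1)[OF r]] by metis+
    have "\<pi> r \<in> {1..n}" unfolding permutes_in_image[OF perm] by (rule rn(2))
    then have "\<pi> r > 0" by simp
    then have 3: "\<pi> r = cyc_succ m p r + m * u r"
      using Psi_decomp[OF assms(1), of "\<pi> r"] 2(2) by (simp add: u_def)
    have "a (k r) * (r + m * t) + b (k r) = (a (k r) * r + b (k r)) + m * (a (k r) * t)"
      by (simp add: algebra_simps)
    moreover have "[(a (k r) * r + b (k r)) + m * (a (k r) * t) = \<pi> r + m * (a (k r) * t)] (mod n)"
      unfolding 2(1) by (intro cong_add cong_refl cong_sym[OF Psi_cong[OF n]])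
    moreover have "\<pi> r + m * (a (k r) * t) = cyc_succ m p r + m * (u r + a (k r) * t)"
      by (simp add: 3 algebra_simps)
    ultimately have "[a (k r) * (r + m * t) + b (k r) =
        cyc_succ m p r + m * (u r + a (k r) * t)] (mod n)"
      by (simp only:)
    then have "[a (k r) * (r + m * t) + b (k r) =
        cyc_succ m p r + m * ((u r + a (k r) * t) mod N)] (mod n)"
      unfolding n_def by (rule cong_trans[OF _ cong_add_mult_mod])
    moreover have "cyc_succ m p r + m * ((u r + a (k r) * t) mod N) \<in> {1..n}"
      unfolding n_def using assms(2) by (intro add_mult_in_range \<sigma>_in[OF r] mod_less_divisor)
    ultimately show ?thesis unfolding 1 by (metis Psi_eqI cong_sym)
  qed
  \<comment> \<open>The definition puts no coprimality on the slopes; it comes from injectivity of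
    \<open>\<pi>\<close>. A common divisor \<open>d > 1\<close> would make the slope times
    \<open>N div d\<close> vanish modulo \<open>N\<close>, so \<open>r\<close> and
    \<open>r + m * (N div d)\<close> would have the same image.\<close>
  have cop: "coprime (a (k r)) N" if r: "r \<in> {1..m}" for r
  proof (rule ccontr)
    define d where "d = gcd (a (k r)) N"
    assume "\<not> coprime (a (k r)) N"
    then have "d \<noteq> 1" unfolding d_def coprime_iff_gcd_eq_1 .
    moreover have "d > 0" using assms(2) by (simp add: d_def)
    ultimately have d: "d > 1" by linarith
    have dvd: "d dvd a (k r)" "d dvd N" by (simp_all add: d_def)
    define t where "t = N div d"
    have t: "t < N" "t > 0" "d * t = N" using d dvd assms by (auto simp: t_def dvd_div_eq_0_iff)
    obtain e where e: "a (k r) = d * e" using dvd by auto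
    have "a (k r) * t = e * N" using e t by (simp add: algebra_simps)
    then have "\<pi> (r + m * t) = \<pi> (r + m * 0)"
      using form[OF r t(1)] form[OF r assms(2)] by simp
    then have "r + m * t = r + m * 0" by (rule injD[OF permutes_inj[OF perm]])
    then show False using t assms by simp
  qed
  \<comment> \<open>Slope and offset are reduced modulo \<open>N\<close> to their canonical ranges,
    which leaves the affine map on quotients unchanged.\<close>
  define g where "g = (\<lambda>r\<in>{1..m}. (Psi N (a (k r)), u r mod N))"
  have "g \<in> {1..m} \<rightarrow>\<^sub>E totatives N \<times> {..<N}"
  proof (rule PiE_I)
    fix r assume r: "r \<in> {1..m}"
    have "coprime (Psi N (a (k r))) N"
      using cong_imp_coprime[OF cong_sym[OF Psi_cong[OF assms(2)]] cop[OF r]] .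
    then show "g r \<in> totatives N \<times> {..<N}"
      using r Psi_in[OF assms(2)] assms by (auto simp: g_def totatives_def Suc_le_eq)
  qed (simp only: g_def restrict_apply if_False)
  with p have "(p, g) \<in> pap_params m N" by simp
  moreover have "\<pi> x = pap_of m N p g x" for x
  proof (cases "x \<in> {1..m * N}")
    case True
    obtain r t where rt: "r \<in> {1..m}" "t < N" "x = r + m * t"
      using residue_quot_cases[OF assms(1) True] .
    have "[u r mod N + Psi N (a (k r)) * t = u r + a (k r) * t] (mod N)"
      using Psi_cong[OF assms(2)] by (intro cong_add cong_mult) auto
    then show ?thesis
      using rt form[OF rt(1,2)] pap_of_apply[OF rt(1,2), of p g] by (simp add: g_def cong_def)
  next
    case False
    then show ?thesis
      using permutes_not_in[OF perm, of x] unfolding pap_of_def n_def by (simp only: if_False simp_thms)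
  qed
  ultimately show ?thesis using that by blast
qed

section \<open>The count and its closed form\<close>

theorem card_pap:
  assumes "m > 0" "N > 0"
  shows "card {\<pi>. pap (m * N) m \<pi>} = fact (m - 1) * (N * totient N) ^ m"
proof -
  have "{\<pi>. pap (m * N) m \<pi>} = (\<lambda>(p, g). pap_of m N p g) ` pap_params m N"
  proof (intro equalityI subsetI)
    fix \<pi> assume "\<pi> \<in> {\<pi>. pap (m * N) m \<pi>}"
    then obtain p g where "(p, g) \<in> pap_params m N" "\<pi> = pap_of m N p g"
      using pap_imp_pap_of[OF assms] by blast
    then show "\<pi> \<in> (\<lambda>(p, g). pap_of m N p g) ` pap_params m N" by (intro image_eqI[of _ _ "(p, g)"]) simp_all
  next
    fix \<pi> assume "\<pi> \<in> (\<lambda>(p, g). pap_of m N p g) ` pap_params m N"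
    then obtain z where z: "\<pi> = (\<lambda>(p, g). pap_of m N p g) z" "z \<in> pap_params m N"
      by (rule imageE)
    obtain p g where "z = (p, g)" by (cases z)
    then show "\<pi> \<in> {\<pi>. pap (m * N) m \<pi>}"
      using z pap_pap_of[OF assms, of p g] by (simp only: mem_Collect_eq prod.case)
  qed
  then have "card {\<pi>. pap (m * N) m \<pi>} = card (pap_params m N)"
    using card_image[OF pap_of_inj[OF assms]] by simp
  also have "\<dots> = fact (m - 1) * (N * totient N) ^ m"
    by (simp add: card_cartesian_product card_permutations[OF refl] card_PiE totient_def ac_simps)
  finally show ?thesis .
qed

text \<open>By Euler's product formula, the ratio of the totient to its argument is the product of
  \<open>1 - 1/p\<close> over the prime divisors \<open>p\<close>, so it depends only on
  these.\<close>

lemma totient_eq_of_prime_factors_eq: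
  assumes "prime_factors a = prime_factors b"
  shows "real b * totient a = real a * totient b"
  using assms by (simp add: totient_formula2)

theorem corollary2p6:
  fixes n m n1 n2 :: nat
  assumes "n > 0"
    and "m > 1"
    and "m dvd n"
    and "n = n1 * n2"
    and "rad n1 dvd n div m"
    and "coprime n2 (n div m)"
  shows "real (card {\<pi>. pap n m \<pi>}) =
    fact (m - 1) * (real (n * n2 * totient n1) / real (m ^ 2)) ^ m"
proof -
  define N where "N = n div m"
  have n: "n = m * N" using assms by (simp add: N_def)
  have pos: "m > 0" "N > 0" "n1 > 0" using assms n by (auto intro: Nat.gr0I)
  \<comment> \<open>A prime dividing \<open>n1\<close> divides \<open>rad n1\<close> and hence
    \<open>N\<close>. Conversely a prime dividing \<open>N\<close> divides \<open>n1 * n2\<close>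
    but not \<open>n2\<close>, which is coprime to \<open>N\<close>.\<close>
  have "prime_factors n1 = prime_factors N"
  proof (intro equalityI subsetI)
    fix q assume q: "q \<in> prime_factors n1"
    then have "q dvd rad n1" unfolding rad_def by (intro dvd_prodI) auto
    then show "q \<in> prime_factors N"
      using q assms(5) pos by (auto simp: N_def prime_factors_dvd intro: dvd_trans)
  next
    fix q assume "q \<in> prime_factors N"
    then have q: "prime q" "q dvd N" by (auto simp: prime_factors_dvd)
    then have "q dvd n1 * n2" using n assms(4) by (metis dvd_mult)
    moreover have "\<not> q dvd n2"
      using assms(6) q coprime_common_divisor_nat not_prime_1 unfolding N_def by blast
    ultimately show "q \<in> prime_factors n1"
      using q pos by (auto simp: prime_dvd_mult_iff prime_factors_dvd)
  qed
  then have tot: "real N * totient n1 = real n1 * totient N"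
    by (rule totient_eq_of_prime_factors_eq)
  \<comment> \<open>The extra factor \<open>N\<close> lets \<open>tot\<close> trade the totient of
    \<open>n1\<close> for that of \<open>N\<close>; the \<open>n1\<close> released combines with
    \<open>n2\<close> to \<open>n\<close>, and \<open>N > 0\<close> is cancelled at the end.\<close>
  have "real N * (real n * real n2 * totient n1) = real n * real n2 * (real N * totient n1)"
    by (simp only: ac_simps)
  also have "\<dots> = real n * (real n1 * real n2) * totient N"
    unfolding tot by (simp only: ac_simps)
  also have "\<dots> = real N * (m ^ 2 * (real N * totient N))"
    unfolding of_nat_mult[symmetric] assms(4)[symmetric] by (simp add: n power2_eq_square)
  finally have "real (n * n2 * totient n1) / real (m ^ 2) = real (N * totient N)"
    using pos by (simp add: field_simps)
  then show ?thesis using card_pap[OF pos(1,2)] n by simp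
qed

end
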